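(* Let $f(x)=ax^2+bx+c$ be a primitive quadratic polynomial with integer coefficients, $a\ge1$, and discriminant $D=b^2-4ac$. Let $k$ be a positive integer. The function $g_{k,f}$ is eventually periodic if and only if $D\ne a^2i^2$ for all integers $i$ with $1\le i\le k$. Furthermore, if $g_{k,f}$ is eventually periodic, then $B_k=\mathrm{lcm}_{1\le i\le k}\{i(a^2i^2-D)\}$ is a period of it.
   Context: Primitive means $\gcd(a,b,c)=1$. $\mathbb{N}^*$ is the set of positive integers. Let $Z_{k,f}=\bigcup_{i=0}^k\{n\in\mathbb{N}^*: f(n+i)=0\}$ (a finite set). For $n\in\mathbb{N}^*\setminus Z_{k,f}$ define $g_{k,f}(n)=\frac{\prod_{i=0}^k|f(n+i)|}{\mathrm{lcm}_{0\le i\le k}\{f(n+i)\}}$. All lcm's are taken positive. The function $g_{k,f}$ is eventually periodic if there are positive integers $t$ and $n_0$ such that $g_{k,f}(n+t)=g_{k,f}(n)$ for all integers $n\ge n_0$; such a $t$ is called a period of $g_{k,f}$. *)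

theory Defs
  imports Complex_Main "HOL-Computational_Algebra.Polynomial"
begin

definition Z_set :: "nat \<Rightarrow> int poly \<Rightarrow> nat set" where
  "Z_set k f = (\<Union>i\<in>{0..k}. {n. n > 0 \<and> poly f (int (n + i)) = 0})"

text \<open>On integers, \<^const>\<open>Lcm\<close> is the nonnegative least common multiple. The
  quotient is meaningful only for positive \<open>n\<close> outside \<^term>\<open>Z_set k f\<close>
  (on the exceptional set it is \<open>0 / 0 = 0\<close>).\<close>

definition g_fun :: "nat \<Rightarrow> int poly \<Rightarrow> nat \<Rightarrow> rat" where
  "g_fun k f n =
     of_int (\<Prod>i=0..k. \<bar>poly f (int (n + i))\<bar>) /
     of_int (Lcm ((\<lambda>i. poly f (int (n + i))) ` {0..k}))"

text \<open>The requirement \<open>n \<notin> Z_set k f\<close> makes explicit that the equation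
  is only between values at arguments in the domain; it also covers \<open>n + t\<close>,
  since \<open>n + t \<ge> n0\<close>.\<close>

definition is_period :: "nat \<Rightarrow> int poly \<Rightarrow> nat \<Rightarrow> bool" where
  "is_period k f t \<longleftrightarrow>
     t > 0 \<and> (\<exists>n0>0. \<forall>n\<ge>n0. n \<notin> Z_set k f \<and> g_fun k f (n + t) = g_fun k f n)"

definition eventually_periodic :: "nat \<Rightarrow> int poly \<Rightarrow> bool" where
  "eventually_periodic k f \<longleftrightarrow> (\<exists>t. is_period k f t)"

definition B_lcm :: "int \<Rightarrow> int \<Rightarrow> nat \<Rightarrow> int" where
  "B_lcm a D k = Lcm ((\<lambda>i. i * (a\<^sup>2 * i\<^sup>2 - D)) ` {1..int k})"

end

(* Since gcd distributes over lcm, the quotient of a product by the lcm of its factors is a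
   product of lcm's of pairwise gcd's of the factors.  With u = 2 a x + a d + b one has
   f (x + d) - f x = d u and 4 a f x = u (u - 2 a d) + (a^2 d^2 - D), so
   gcd (f x) (f (x + d)) divides d (a^2 d^2 - D).  If these numbers are nonzero, all the
   pairwise gcd's divide B_k and hence depend only on n modulo B_k.
   If D = a^2 i^2, then f x and f (x + i) share, up to the factor 4 a, the linear factor
   2 a x + b + a i; so their gcd, and with it g, is unbounded along every arithmetic
   progression, which a periodic function is not. *)
theory Submission
  imports Defs
begin

lemma gcd_Lcm_distrib:
  fixes x :: "'a :: {factorial_semiring_gcd, semiring_Gcd}"
  assumes "finite A"
  shows "gcd (Lcm A) x = Lcm ((\<lambda>a. gcd a x) ` A)"
  using assms by (induction A) (simp_all add: gcd.commute[of _ x] gcd_lcm_distrib)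

text \<open>Induction on \<open>m\<close>: appending \<open>s m\<close> multiplies the product by
  \<open>\<bar>s m\<bar>\<close>, and the lcm absorbs all of it except the gcd of \<open>s m\<close>
  with the old lcm.\<close>

lemma prod_abs_eq_Lcm_mult_pairwise_gcd:
  fixes s :: "nat \<Rightarrow> int"
  shows "(\<Prod>i<m. \<bar>s i\<bar>) =
    Lcm (s ` {..<m}) * (\<Prod>j<m. Lcm ((\<lambda>i. gcd (s i) (s j)) ` {..<j}))"
proof (induction m)
  case 0
  then show ?case by simp
next
  case (Suc m)
  let ?L = "Lcm (s ` {..<m})"
  have "?L * \<bar>s m\<bar> = lcm ?L (s m) * gcd ?L (s m)"
    by (metis abs_mult abs_idempotent lcm_mult_gcd normalize_Lcm normalize_int_def normalize_mult)
  also have "gcd ?L (s m) = Lcm ((\<lambda>i. gcd (s i) (s m)) ` {..<m})"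
    by (simp add: gcd_Lcm_distrib image_image)
  also have "lcm ?L (s m) = Lcm (s ` {..<Suc m})"
    by (simp add: lessThan_Suc lcm.commute)
  finally show ?case
    using Suc.IH by (simp add: ac_simps)
qed

text \<open>The cofactor of the lcm in the identity above. It sees \<open>f\<close> only through
  pairwise gcd's, so periodicity can be checked on each gcd separately.\<close>

definition gcd_prod :: "nat \<Rightarrow> int poly \<Rightarrow> nat \<Rightarrow> int" where
  "gcd_prod k f n =
     (\<Prod>j<Suc k. Lcm ((\<lambda>i. gcd (poly f (int (n + i))) (poly f (int (n + j)))) ` {..<j}))"

lemma poly_nonzero_if_notin_Z_set:
  assumes "n > 0" "n \<notin> Z_set k f" "i \<le> k"
  shows "poly f (int (n + i)) \<noteq> 0"
  using assms by (auto simp: Z_set_def)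

lemma g_fun_eq_gcd_prod:
  assumes "n > 0" "n \<notin> Z_set k f"
  shows "g_fun k f n = of_int (gcd_prod k f n)"
proof -
  let ?s = "\<lambda>i. poly f (int (n + i))"
  have idx: "{0..k} = {..<Suc k}" by auto
  have "0 \<notin> ?s ` {..<Suc k}"
    using poly_nonzero_if_notin_Z_set[OF assms] by fastforce
  then have "Lcm (?s ` {..<Suc k}) \<noteq> 0"
    by (simp add: Lcm_0_iff del: of_nat_add)
  then show ?thesis
    unfolding g_fun_def gcd_prod_def idx prod_abs_eq_Lcm_mult_pairwise_gcd[of ?s] by simp
qed

text \<open>Lets a single large gcd force a large value of g. Off the zeros all factors are
  positive, which turns divisibility into an inequality.\<close>

lemma gcd_le_gcd_prod:
  assumes "n > 0" "n \<notin> Z_set k f" "i < j" "j \<le> k"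
  shows "gcd (poly f (int (n + i))) (poly f (int (n + j))) \<le> gcd_prod k f n"
proof (rule zdvd_imp_le)
  let ?s = "\<lambda>i. poly f (int (n + i))"
  let ?h = "\<lambda>j. Lcm ((\<lambda>i. gcd (?s i) (?s j)) ` {..<j})"
  have "gcd (?s i) (?s j) dvd ?h j"
    using assms(3) by (intro dvd_Lcm) auto
  also have "?h j dvd (\<Prod>j<Suc k. ?h j)"
    using assms(4) by (intro dvd_prodI) auto
  finally show "gcd (?s i) (?s j) dvd gcd_prod k f n"
    by (simp add: gcd_prod_def)
  show "0 < gcd_prod k f n"
    unfolding gcd_prod_def
  proof (rule prod_pos)
    fix j assume j: "j \<in> {..<Suc k}"
    then have "?s j \<noteq> 0"
      using poly_nonzero_if_notin_Z_set[OF assms(1,2)] by simp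
    then have "?h j \<noteq> 0"
      by (auto simp: Lcm_0_iff simp del: of_nat_add)
    moreover have "?h j \<ge> 0"
      by (metis abs_ge_zero normalize_Lcm normalize_int_def)
    ultimately show "0 < ?h j" by linarith
  qed
qed

lemma gcd_quadratic_shift_dvd:
  fixes a b c x d :: int
  defines "f \<equiv> [:c, b, a:]"
  shows "gcd (poly f x) (poly f (x + d)) dvd d * (a\<^sup>2 * d\<^sup>2 - (b\<^sup>2 - 4 * a * c))"
proof -
  define u where "u = 2 * a * x + a * d + b"
  \<comment> \<open>This is \<open>d\<close> times the formula for \<open>4 * a * poly f x\<close>,
    with \<open>d * u\<close> replaced by the difference of the two values.\<close>
  have "d * (a\<^sup>2 * d\<^sup>2 - (b\<^sup>2 - 4 * a * c)) =
      4 * a * d * poly f x - (u - 2 * a * d) * (poly f (x + d) - poly f x)"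
    unfolding u_def f_def by (simp add: power2_eq_square algebra_simps)
  then show ?thesis by simp
qed

lemma dvd_poly_shift_diff:
  fixes f :: "int poly"
  shows "m dvd poly f (x + m) - poly f x"
proof (induction f)
  case (pCons c f)
  have "poly (pCons c f) (x + m) - poly (pCons c f) x =
      x * (poly f (x + m) - poly f x) + m * poly f (x + m)"
    by (simp add: algebra_simps)
  then show ?case using pCons.IH by simp
qed simp

text \<open>Shifting by \<open>m\<close> preserves values modulo every divisor of \<open>m\<close>.
  Each gcd is such a divisor, so each divides the other.\<close>

lemma gcd_poly_shift_eq:
  fixes f :: "int poly"
  assumes "gcd (poly f x) (poly f y) dvd m"
    and "gcd (poly f (x + m)) (poly f (y + m)) dvd m"
  shows "gcd (poly f (x + m)) (poly f (y + m)) = gcd (poly f x) (poly f y)"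
proof -
  have iff: "p dvd poly f (z + m) \<longleftrightarrow> p dvd poly f z" if "p dvd m" for p z
    using dvd_trans[OF that dvd_poly_shift_diff[of m f z]]
    by (metis dvd_diff_right_iff dvd_diff_left_iff dvd_add_right_iff diff_add_cancel)
  show ?thesis
    by (rule zdvd_antisym_nonneg)
      (use iff[OF assms(1)] iff[OF assms(2)] in \<open>auto intro!: gcd_greatest\<close>)
qed

lemma eventually_notin_Z_set:
  fixes a b c :: int
  assumes "a \<ge> 1" "int n > \<bar>b\<bar> + \<bar>c\<bar>"
  shows "n \<notin> Z_set k [:c, b, a:]"
proof -
  have "poly [:c, b, a:] x \<noteq> 0" if x: "x > \<bar>b\<bar> + \<bar>c\<bar>" for x :: int
  proof -
    have "x \<le> a * x" using assms(1) x by (simp add: mult_le_cancel_right1)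
    then have "\<bar>c\<bar> + 1 \<le> a * x + b" using x by linarith
    then have "x * (\<bar>c\<bar> + 1) \<le> x * (a * x + b)"
      using x by (intro mult_left_mono) auto
    moreover have "\<bar>c\<bar> \<le> x * \<bar>c\<bar>" using x mult_right_mono[of 1 x "\<bar>c\<bar>"] by simp
    ultimately have "x * (a * x + b) + c > 0"
      using x by (simp add: distrib_left)
    then show ?thesis by (simp add: algebra_simps)
  qed
  from this[of "int (n + i)" for i] show ?thesis
    using assms(2) by (auto simp: Z_set_def simp del: poly_pCons)
qed

lemma is_period_B_lcm:
  fixes a b c D :: int
  assumes f: "f = [:c, b, a:]" and "a \<ge> 1" and D: "D = b\<^sup>2 - 4 * a * c"
    and ne: "\<forall>i::int. 1 \<le> i \<and> i \<le> int k \<longrightarrow> D \<noteq> a\<^sup>2 * i\<^sup>2"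
  shows "is_period k f (nat (B_lcm a D k))"
proof -
  let ?B = "B_lcm a D k"
  have "0 \<notin> (\<lambda>i. i * (a\<^sup>2 * i\<^sup>2 - D)) ` {1..int k}"
    using ne by auto
  then have "?B \<noteq> 0"
    by (simp add: B_lcm_def Lcm_0_iff)
  moreover have "?B \<ge> 0"
    unfolding B_lcm_def by (metis abs_ge_zero normalize_Lcm normalize_int_def)
  ultimately have B: "?B > 0" by linarith
  have dvd_B: "gcd (poly f (x + int i)) (poly f (x + int j)) dvd ?B"
    if "i < j" "j \<le> k" for x i j
  proof -
    let ?d = "int j - int i"
    have "gcd (poly f (x + int i)) (poly f (x + int i + ?d)) dvd ?d * (a\<^sup>2 * ?d\<^sup>2 - D)"
      unfolding f D by (rule gcd_quadratic_shift_dvd)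
    \<comment> \<open>Since \<open>?d\<close> lies between 1 and \<open>k\<close>, this is one of
      the numbers whose lcm is \<open>?B\<close>.\<close>
    also have "\<dots> dvd ?B"
      unfolding B_lcm_def using that by (intro dvd_Lcm imageI) auto
    finally show ?thesis by simp
  qed
  \<comment> \<open>This holds at every \<open>n\<close>; only the passage to \<open>g_fun\<close>
    requires going beyond the zeros.\<close>
  have "gcd_prod k f (n + nat ?B) = gcd_prod k f n" for n
    unfolding gcd_prod_def
  proof (intro prod.cong refl arg_cong[where f = Lcm] image_cong)
    fix i j assume "j \<in> {..<Suc k}" "i \<in> {..<j}"
    then show "gcd (poly f (int (n + nat ?B + i))) (poly f (int (n + nat ?B + j))) =
        gcd (poly f (int (n + i))) (poly f (int (n + j)))"
      using gcd_poly_shift_eq[of f "int n + int i" "int n + int j" ?B]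
        dvd_B[of i j "int n"] dvd_B[of i j "int n + ?B"] B
      by (simp add: ac_simps)
  qed
  moreover obtain N where "N > 0" "\<And>n. n \<ge> N \<Longrightarrow> n \<notin> Z_set k f"
  proof
    show "n \<notin> Z_set k f" if "n \<ge> nat (\<bar>b\<bar> + \<bar>c\<bar> + 1)" for n
      unfolding f using that assms(2) by (intro eventually_notin_Z_set) auto
  qed simp
  ultimately have "\<forall>n\<ge>N. n \<notin> Z_set k f \<and> g_fun k f (n + nat ?B) = g_fun k f n"
    by (simp add: g_fun_eq_gcd_prod)
  then show ?thesis
    unfolding is_period_def using B \<open>N > 0\<close> zero_less_nat_eq by blast
qed

lemma not_eventually_periodic:
  fixes a b c D i :: int
  assumes f: "f = [:c, b, a:]" and a: "a \<ge> 1" and D: "D = b\<^sup>2 - 4 * a * c"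
    and i: "1 \<le> i" "i \<le> int k" and eq: "D = a\<^sup>2 * i\<^sup>2"
  shows "\<not> eventually_periodic k f"
proof
  assume "eventually_periodic k f"
  then obtain t n0 where t: "t > 0" "n0 > 0"
    and per: "\<And>n. n \<ge> n0 \<Longrightarrow> n \<notin> Z_set k f \<and> g_fun k f (n + t) = g_fun k f n"
    unfolding eventually_periodic_def is_period_def by blast
  define C where "C = gcd_prod k f n0"
  \<comment> \<open>As \<open>D\<close> is the square of \<open>a * i\<close>,
    \<open>4 * a * poly f x\<close> splits into \<open>2 * a * x + b + a * i\<close> and
    \<open>2 * a * x + b - a * i\<close>; at \<open>x + i\<close> the second factor becomes the
    first one at \<open>x\<close>.\<close>
  define w where "w = b + a * i"
  have const: "g_fun k f (n0 + t * m) = g_fun k f n0" for m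
  proof (induction m)
    case (Suc m)
    then show ?case using per[of "n0 + t * m"] by (simp add: ac_simps)
  qed simp
  \<comment> \<open>The shared linear factor divides \<open>4 * a\<close> times a gcd that is at
    most the constant value \<open>C\<close>.\<close>
  have bound: "2 * a * int (n0 + t * m) + w \<le> 4 * a * C" for m
  proof -
    define n where "n = n0 + t * m"
    let ?g = "gcd (poly f (int n)) (poly f (int n + i))"
    have n: "n > 0" "n \<notin> Z_set k f" and n0: "n0 \<notin> Z_set k f"
      using per[of n] per[of n0] t by (auto simp: n_def)
    have "of_int (gcd_prod k f n) = (of_int C :: rat)"
      using const[of m] n n0 t by (simp add: g_fun_eq_gcd_prod C_def n_def)
    then have "?g \<le> C"
      using gcd_le_gcd_prod[OF n, of 0 "nat i"] i by simp
    have disc: "4 * a * c = b\<^sup>2 - a\<^sup>2 * i\<^sup>2"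
      using D eq by simp
    have f_fac: "4 * a * poly f x = (2 * a * x + w) * (2 * a * x + w - 2 * a * i)" for x
    proof -
      have "4 * a * poly f x = 4 * a * c + 4 * a * b * x + 4 * a\<^sup>2 * x\<^sup>2"
        unfolding f by (simp add: power2_eq_square algebra_simps)
      then show ?thesis
        unfolding disc w_def by (simp add: power2_eq_square algebra_simps)
    qed
    have "2 * a * int n + w dvd 4 * a * poly f (int n)"
      unfolding f_fac by simp
    moreover have "2 * a * int n + w dvd 4 * a * poly f (int n + i)"
    proof -
      have "2 * a * (int n + i) + w - 2 * a * i = 2 * a * int n + w"
        by (simp add: algebra_simps)
      then show ?thesis
        unfolding f_fac by (metis dvd_triv_right)
    qed
    ultimately have "2 * a * int n + w dvd gcd (4 * a * poly f (int n)) (4 * a * poly f (int n + i))"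
      by (rule gcd_greatest)
    also have "\<dots> = 4 * a * ?g"
      using a by (simp add: gcd_mult_distrib_int[symmetric] mult.assoc)
    finally have dvd: "2 * a * int n + w dvd 4 * a * ?g" .
    have "?g > 0"
      using poly_nonzero_if_notin_Z_set[OF n, of 0] by simp
    then have "2 * a * int n + w \<le> 4 * a * ?g"
      using a by (intro zdvd_imp_le[OF dvd]) simp
    also have "\<dots> \<le> 4 * a * C"
      using a \<open>?g \<le> C\<close> by (intro mult_left_mono) auto
    finally show ?thesis by (simp add: n_def)
  qed
  \<comment> \<open>Large enough to violate \<open>bound\<close>: its left side is then at least
    \<open>4 * a * C + 2 * a * \<bar>w\<bar> + 2 * a + w\<close>, which exceeds
    \<open>4 * a * C\<close>.\<close>
  define m where "m = nat (2 * \<bar>C\<bar> + \<bar>w\<bar> + 1)"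
  have "2 * C + \<bar>w\<bar> + 1 \<le> int m" by (simp add: m_def)
  also have "int m \<le> int (n0 + t * m)"
    using t(1) by (simp add: trans_le_add2 flip: of_nat_mult of_nat_add)
  finally have "2 * a * (2 * C + \<bar>w\<bar> + 1) \<le> 2 * a * int (n0 + t * m)"
    using a by (intro mult_left_mono) auto
  moreover have "\<bar>w\<bar> \<le> a * \<bar>w\<bar>" using a mult_right_mono[of 1 a "\<bar>w\<bar>"] by simp
  ultimately show False
    using bound[of m] a by (simp add: distrib_left)
qed

theorem theorem2p1:
  fixes a b c D :: int and f :: "int poly" and k :: nat
  assumes "f = [:c, b, a:]"
    and "a \<ge> 1"
    and "gcd a (gcd b c) = 1"
    and "D = b\<^sup>2 - 4 * a * c"
    and "k \<ge> 1"
  shows "(eventually_periodic k f \<longleftrightarrow>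
            (\<forall>i::int. 1 \<le> i \<and> i \<le> int k \<longrightarrow> D \<noteq> a\<^sup>2 * i\<^sup>2))
         \<and> (eventually_periodic k f \<longrightarrow> is_period k f (nat (B_lcm a D k)))"
  using is_period_B_lcm[OF assms(1,2,4)] not_eventually_periodic[OF assms(1,2,4)]
  unfolding eventually_periodic_def by blast

end
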